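(* Suppose that $0\le k\le k_{max3}$, where $$k_{max3}=\min\{N-1,\;N+1-N',\;2N-1,\;2N+1-N',\;2N+3-2N'\},$$ and let $g_0,g_1,\dots,g_k$ be given scalar functions of $x$. Then the bilinear constraints $$\sum_{i=0}^{j}\operatorname{Tr}(u_iu_{j-i})=g_j,\qquad j=0,1,\dots,k,$$ are preserved by the Darboux transformation such that $\det T_0\ne0$; that is, if they hold for the $u_i$, then $\sum_{i=0}^{j}\operatorname{Tr}(\tilde u_i\tilde u_{j-i})=g_j$ for $j=0,1,\dots,k$.
   Context: $x=(x^1,x^2)$; $,_1$ denotes the derivative with respect to $x^1$, taking into account the possible dependence of the spectral parameter $\lambda$ on $x$. The linear equation $\Psi,_1=U\Psi$ (one of the two equations of a Lax pair) has $n\times n$ matrix $$U=\sum_{k=0}^\infty u_k\lambda^{N-k}$$ for $\lambda$ near $\infty$, with $N$ a fixed positive integer and $u_k=u_k(x)$ (usually only finitely many are nonzero). The spectral parameter satisfies $\lambda,_1=\sum_{k=0}^\infty a_k\lambda^{N'-k}$ with scalar $a_k=a_k(x)$ and a given integer $N'$ (in the nonisospectral case fixed by requiring $a_0\ne0$; the isospectral case is $\lambda,_1=0$). A Darboux transformation replaces $U$ by $\tilde U=D,_1D^{-1}+DUD^{-1}$, where the Darboux matrix $D$ is analytic at $\lambda=\infty$, $D=T_0+T_1\lambda^{-1}+T_2\lambda^{-2}+\dots$ with $T_k=T_k(x)$, and is such that $\tilde U$ is of the same form as $U$: $\tilde U=\sum_{k\ge0}\tilde u_k\lambda^{N-k}$.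 *)

theory Defs
  imports "HOL-Analysis.Analysis"
begin

type_synonym point = "real \<times> real"
type_synonym 'n cmatrix = "complex ^ 'n ^ 'n"

text \<open>
  \<open>x\<close> and the value \<open>l\<close> of the spectral parameter are treated as independent variables. ``For \<open>l\<close>
  near infinity'' means for \<open>(x, l)\<close> near \<open>(x0, \<infinity>)\<close>, for every \<open>x0\<close> in the domain \<open>X\<close>; the radius of
  the neighbourhood of infinity is thus only locally uniform in \<open>x\<close>.
\<close>

definition near_infinity :: "point set \<Rightarrow> (point \<Rightarrow> complex \<Rightarrow> bool) \<Rightarrow> bool" where
  "near_infinity X P \<longleftrightarrow>
     (\<forall>x0\<in>X. eventually (\<lambda>(x, l). P x l) (nhds x0 \<times>\<^sub>F at_infinity))"

definition has_expansion ::
  "point set \<Rightarrow> int \<Rightarrow> (nat \<Rightarrow> point \<Rightarrow> complex) \<Rightarrow> (point \<Rightarrow> complex \<Rightarrow> complex) \<Rightarrow> bool" where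
  "has_expansion X m c F \<longleftrightarrow>
     near_infinity X (\<lambda>x l. (\<lambda>k. c k x * l powi (m - int k)) sums F x l)"

definition entry :: "'n::finite \<Rightarrow> 'n \<Rightarrow> (point \<Rightarrow> complex \<Rightarrow> 'n cmatrix) \<Rightarrow> point \<Rightarrow> complex \<Rightarrow> complex"
  where "entry i j F = (\<lambda>x l. F x l $ i $ j)"

definition has_matrix_expansion ::
  "point set \<Rightarrow> int \<Rightarrow> (nat \<Rightarrow> point \<Rightarrow> 'n::finite cmatrix) \<Rightarrow> (point \<Rightarrow> complex \<Rightarrow> 'n cmatrix) \<Rightarrow> bool"
  where
  "has_matrix_expansion X m c F \<longleftrightarrow>
     (\<forall>i j. has_expansion X m (\<lambda>k x. c k x $ i $ j) (entry i j F))"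

text \<open>
  \<open>L x l\<close> is the right-hand side of the evolution equation of the spectral parameter. The exponent
  \<open>N'\<close> is normalised by \<open>a 0 \<noteq> 0\<close> as a function, except in the isospectral case.
\<close>

definition spectral_evolution ::
  "point set \<Rightarrow> int \<Rightarrow> (nat \<Rightarrow> point \<Rightarrow> complex) \<Rightarrow> (point \<Rightarrow> complex \<Rightarrow> complex) \<Rightarrow> bool" where
  "spectral_evolution X N' a L \<longleftrightarrow>
     has_expansion X N' a L \<and>
     ((\<forall>k. \<forall>x\<in>X. a k x = 0) \<or> (\<exists>x\<in>X. a 0 x \<noteq> 0))"

definition partial1 :: "(point \<Rightarrow> complex \<Rightarrow> complex) \<Rightarrow> point \<Rightarrow> complex \<Rightarrow> complex" where
  "partial1 F x l = vector_derivative (\<lambda>s. F (s, snd x) l) (at (fst x))"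

text \<open>
  The derivative with respect to the first coordinate that takes into account the dependence of the
  spectral parameter on \<open>x\<close>; lemma \<open>total1_along\<close> identifies it with the derivative of
  \<open>F (x, \<lambda>(x))\<close> for any function \<open>\<lambda>\<close> satisfying the evolution equation.
\<close>

definition total1 ::
  "(point \<Rightarrow> complex \<Rightarrow> complex) \<Rightarrow> (point \<Rightarrow> complex \<Rightarrow> complex) \<Rightarrow> point \<Rightarrow> complex \<Rightarrow> complex" where
  "total1 L F x l = partial1 F x l + deriv (F x) l * L x l"

lemma total1_along:
  fixes F L :: "point \<Rightarrow> complex \<Rightarrow> complex" and \<Lambda> :: "point \<Rightarrow> complex"
  assumes F: "((\<lambda>(s, l). F (s, x2) l) has_derivative F') (at (x1, \<Lambda> (x1, x2)))"
    and hol: "F (x1, x2) field_differentiable at (\<Lambda> (x1, x2))"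
    and evol: "((\<lambda>s. \<Lambda> (s, x2)) has_vector_derivative L (x1, x2) (\<Lambda> (x1, x2))) (at x1)"
  shows "((\<lambda>s. F (s, x2) (\<Lambda> (s, x2))) has_vector_derivative
           total1 L F (x1, x2) (\<Lambda> (x1, x2))) (at x1)"
proof -
  let ?l = "\<Lambda> (x1, x2)"
  let ?v = "L (x1, x2) ?l"
  have lin: "linear F'" using F has_derivative_linear by blast
  have c1: "((\<lambda>s. (s, \<Lambda> (s, x2))) has_derivative (\<lambda>h. (h, h *\<^sub>R ?v))) (at x1)"
    using evol unfolding has_vector_derivative_def by (intro has_derivative_Pair) auto
  have main: "((\<lambda>s. F (s, x2) (\<Lambda> (s, x2))) has_derivative (\<lambda>h. F' (h, h *\<^sub>R ?v))) (at x1)"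
    using has_derivative_compose[OF c1, of "\<lambda>(s, l). F (s, x2) l" F'] F by simp
  have c2: "((\<lambda>s. (s, ?l)) has_derivative (\<lambda>h. (h, 0))) (at x1)"
    by (intro has_derivative_Pair) auto
  have p: "((\<lambda>s. F (s, x2) ?l) has_derivative (\<lambda>h. F' (h, 0))) (at x1)"
    using has_derivative_compose[OF c2, of "\<lambda>(s, l). F (s, x2) l" F'] F by simp
  have eq: "(\<lambda>h. F' (h, 0)) = (\<lambda>h. h *\<^sub>R F' (1, 0))"
  proof
    fix h :: real
    have "F' (h, 0) = F' (h *\<^sub>R (1, 0))" by simp
    also have "\<dots> = h *\<^sub>R F' (1, 0)" by (rule linear_scale[OF lin])
    finally show "F' (h, 0) = h *\<^sub>R F' (1, 0)" .
  qed
  have p1: "partial1 F (x1, x2) ?l = F' (1, 0)"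
    unfolding partial1_def fst_conv snd_conv
    by (rule vector_derivative_at, unfold has_vector_derivative_def)
      (rule has_derivative_eq_rhs[OF p eq])
  have c3: "((\<lambda>l. (x1, l)) has_derivative (\<lambda>h. (0, h))) (at ?l)"
    by (intro has_derivative_Pair) auto
  have q: "(F (x1, x2) has_derivative (\<lambda>h. F' (0, h))) (at ?l)"
    using has_derivative_compose[OF c3, of "\<lambda>(s, l). F (s, x2) l" F'] F by simp
  have "(F (x1, x2) has_derivative (\<lambda>h. deriv (F (x1, x2)) ?l * h)) (at ?l)"
    using hol field_differentiable_derivI has_field_derivative_def by blast
  then have "(\<lambda>h. F' (0, h)) = (\<lambda>h. deriv (F (x1, x2)) ?l * h)"
    using has_derivative_unique[OF q] by blast
  then have q1: "F' (0, h) = deriv (F (x1, x2)) ?l * h" for h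
    by (rule fun_cong)
  have fin: "F' (h, h *\<^sub>R ?v) = h *\<^sub>R total1 L F (x1, x2) ?l" for h :: real
  proof -
    have "F' (1, ?v) = F' (1, 0) + F' (0, ?v)"
      using linear_add[OF lin, of "(1, 0)" "(0, ?v)"] by simp
    then have "F' (1, ?v) = total1 L F (x1, x2) ?l"
      unfolding total1_def p1 q1 .
    then show ?thesis
      using linear_scale[OF lin, of h "(1, ?v)"]
      by (simp only: scaleR_Pair real_scaleR_def mult_1_right)
  qed
  show ?thesis
    using main unfolding has_vector_derivative_def fin .
qed

definition matrix_total1 ::
  "(point \<Rightarrow> complex \<Rightarrow> complex) \<Rightarrow> (point \<Rightarrow> complex \<Rightarrow> 'n::finite cmatrix) \<Rightarrow>
     point \<Rightarrow> complex \<Rightarrow> 'n cmatrix" where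
  "matrix_total1 L F x l = (\<chi> i j. total1 L (entry i j F) x l)"

text \<open>
  The smoothness needed to differentiate the Darboux matrix; no differentiability in the second
  coordinate is required, and regularity of the coefficients of the expansion is not assumed.
\<close>

definition C1_in_x1 :: "point set \<Rightarrow> (point \<Rightarrow> complex \<Rightarrow> 'n::finite cmatrix) \<Rightarrow> bool" where
  "C1_in_x1 X F \<longleftrightarrow>
     (\<forall>i j. near_infinity X (\<lambda>x l.
        (\<lambda>s. entry i j F (s, snd x) l) differentiable (at (fst x)) \<and>
        isCont (\<lambda>(y, m). partial1 (entry i j F) y m) (x, l)))"

definition darboux ::
  "(point \<Rightarrow> complex \<Rightarrow> complex) \<Rightarrow> (point \<Rightarrow> complex \<Rightarrow> 'n::finite cmatrix) \<Rightarrow>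
     (point \<Rightarrow> complex \<Rightarrow> 'n cmatrix) \<Rightarrow> point \<Rightarrow> complex \<Rightarrow> 'n cmatrix" where
  "darboux L D U x l =
     matrix_total1 L D x l ** matrix_inv (D x l) + D x l ** U x l ** matrix_inv (D x l)"

definition kmax3 :: "int \<Rightarrow> int \<Rightarrow> int" where
  "kmax3 N N' = Min {N - 1, N + 1 - N', 2 * N - 1, 2 * N + 1 - N', 2 * N + 3 - 2 * N'}"

end

theory Submission
  imports Defs "HOL-Complex_Analysis.Laurent_Convergence" "HOL-Complex_Analysis.Conformal_Mappings"
begin

text \<open>
  The sums \<open>\<Sum>i\<le>j. Tr (u\<^sub>i u\<^sub>j\<^sub>-\<^sub>i)\<close> are the coefficients of \<open>l\<^sup>2\<^sup>N\<^sup>-\<^sup>j\<close> in \<open>Tr U\<^sup>2\<close>. With \<open>M = D,\<^sub>1 D\<^sup>-\<^sup>1\<close> the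
  transformed trace is \<open>Tr U\<^sup>2 + 2 Tr (M D U D\<^sup>-\<^sup>1) + Tr M\<^sup>2\<close>. Since \<open>\<partial>D/\<partial>x\<^sup>1\<close> and \<open>D\<^sup>-\<^sup>1\<close> are bounded near
  \<open>l = \<infinity>\<close> and \<open>\<partial>D/\<partial>l = O(l\<^sup>-\<^sup>2)\<close>, we have \<open>M = O(l powi max 0 (N' - 2))\<close>, so the extra terms do not reach
  the powers \<open>l\<^sup>2\<^sup>N\<^sup>-\<^sup>j\<close> with \<open>j \<le> k\<close>. Everything is computed in the local parameter \<open>w = 1/l\<close> at \<open>0\<close>.
\<close>

no_notation fps_nth (infixl "$" 75)

section \<open>Expansions at infinity as power series in \<open>w = 1/l\<close>\<close>

text \<open>An eventual property for a product filter splits into one condition on each factor. The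
  point of the lemma is that a single radius \<open>R\<close> then serves all \<open>y\<close> close
  to \<open>x\<close>.\<close>

lemma near_infinityE:
  assumes "near_infinity X P" "x \<in> X"
  obtains Q R where "eventually Q (nhds x)" "R > 0" "\<And>y l. Q y \<Longrightarrow> norm l \<ge> R \<Longrightarrow> P y l"
proof -
  obtain Q S where QS: "eventually Q (nhds x)" "eventually S at_infinity"
    "\<And>y l. Q y \<Longrightarrow> S l \<Longrightarrow> P y l"
    using assms unfolding near_infinity_def eventually_prod_filter by fastforce
  obtain R where "R > 0" "\<And>l. norm l \<ge> R \<Longrightarrow> S l"
    using QS(2) unfolding eventually_at_infinity_pos by blast
  with QS show ?thesis using that by blast
qed

lemma near_infinity_at_0:
  assumes "near_infinity X P" "x \<in> X"
  shows "eventually (\<lambda>w. P x (inverse w)) (at 0)"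
proof -
  obtain Q R where *: "eventually Q (nhds x)" "R > 0" "\<And>y l. Q y \<Longrightarrow> norm l \<ge> R \<Longrightarrow> P y l"
    using near_infinityE[OF assms] by blast
  have "eventually (\<lambda>l. P x l) at_infinity"
    unfolding eventually_at_infinity using * eventually_nhds_x_imp_x[of Q x] by blast
  then show ?thesis
    using filterlim_inverse_at_infinity unfolding filterlim_iff by blast
qed

text \<open>Both series differ by the nonzero factor \<open>l powi (- m)\<close>, which does not
  affect convergence. It turns the Laurent-type expansion at infinity into an ordinary power series
  in \<open>inverse l\<close>.\<close>

lemma power_int_expansion:
  fixes l :: complex
  assumes "l \<noteq> 0"
  shows "(\<lambda>k. c k * l powi (m - int k)) sums S \<longleftrightarrow>
         (\<lambda>k. c k * inverse l ^ k) sums (l powi (- m) * S)"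
proof -
  have *: "c k * inverse l ^ k = l powi (- m) * (c k * l powi (m - int k))" for k
    using assms by (simp add: power_int_diff power_int_minus field_simps)
  have nz: "l powi (- m) \<noteq> 0" using assms by simp
  show ?thesis
    unfolding * by (subst sums_mult_iff[OF nz]) (rule refl)
qed

text \<open>For fixed \<open>x\<close>, convergence at one nonzero \<open>w\<close> already gives
  the formal series a positive radius of convergence, so \<open>f\<close> can be taken as its sum.
  Results on holomorphic functions then apply without any regularity of the coefficients in
  \<open>x\<close>.\<close>

lemma has_expansion_imp_fps:
  assumes "has_expansion X m c F" "x \<in> X"
  obtains f where "f has_fps_expansion Abs_fps (\<lambda>k. c k x)"
    "eventually (\<lambda>w. F x (inverse w) = w powi (- m) * f w) (at 0)"
proof -
  let ?A = "Abs_fps (\<lambda>k. c k x)"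
  have "eventually (\<lambda>w. (\<lambda>k. c k x * inverse w powi (m - int k)) sums F x (inverse w)) (at 0)"
    using near_infinity_at_0 assms unfolding has_expansion_def by blast
  then have ev: "eventually (\<lambda>w. w \<noteq> 0 \<and> (\<lambda>k. c k x * w ^ k) sums (w powi m * F x (inverse w))) (at 0)"
    using eventually_neq_at_within[of 0 0 UNIV]
  proof eventually_elim
    case (elim w)
    then show ?case
      using power_int_expansion[of "inverse w" "\<lambda>k. c k x" m "F x (inverse w)"]
      by (simp add: power_int_inverse power_int_minus)
  qed
  \<comment> \<open>The filter \<open>at 0\<close> is nontrivial, so an eventual property holds at
    some actual point.\<close>
  obtain w0 where w0: "w0 \<noteq> 0" "summable (\<lambda>k. c k x * w0 ^ k)"
    using eventually_happens[OF ev] sums_summable by auto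
  have "fps_conv_radius ?A \<ge> norm w0"
    using conv_radius_geI[OF w0(2)] by (simp add: fps_conv_radius_def)
  then have "fps_conv_radius ?A > 0"
    using w0(1) by (metis ereal_less(2) less_le_trans zero_less_norm_iff)
  then have "eval_fps ?A has_fps_expansion ?A"
    by (rule eval_fps_has_fps_expansion)
  moreover have "eventually (\<lambda>w. F x (inverse w) = w powi (- m) * eval_fps ?A w) (at 0)"
    using ev
  proof eventually_elim
    case (elim w)
    then have "eval_fps ?A w = w powi m * F x (inverse w)"
      by (simp add: eval_fps_def sums_iff)
    then show ?case using elim by (simp add: power_int_minus)
  qed
  ultimately show ?thesis using that by blast
qed

lemma has_fps_expansion_bigo_1:
  fixes f :: "complex \<Rightarrow> complex"
  assumes "f has_fps_expansion F"
  shows "f \<in> O[at 0](\<lambda>_. 1)"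
proof (rule bigoI_tendsto)
  show "((\<lambda>w. f w / 1) \<longlongrightarrow> fps_nth F 0) (at 0)"
    using has_fps_expansion_imp_tendsto_0[OF assms] by (simp add: tendsto_nhds_iff)
qed simp

lemma has_expansion_bigo:
  assumes "has_expansion X m c F" "x \<in> X"
  shows "(\<lambda>w. F x (inverse w)) \<in> O[at 0](\<lambda>w. w powi (- m))"
proof -
  obtain f where f: "f has_fps_expansion Abs_fps (\<lambda>k. c k x)"
    and ev: "eventually (\<lambda>w. F x (inverse w) = w powi (- m) * f w) (at 0)"
    using has_expansion_imp_fps[OF assms] .
  have "(\<lambda>w. w powi (- m) * f w) \<in> O[at 0](\<lambda>w. w powi (- m) * 1)"
    by (intro landau_o.big.mult_left has_fps_expansion_bigo_1[OF f])
  then show ?thesis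
    using landau_o.big.in_cong[OF ev] by simp
qed

text \<open>With \<open>F x l = f (1/l)\<close> the chain rule gives the derivative
  \<open>- w^2 * f'(w)\<close> at \<open>l = 1/w\<close>, and \<open>f'\<close> is bounded near 0
  because \<open>f\<close> is holomorphic there.\<close>

lemma has_expansion_0_deriv_bigo:
  assumes "has_expansion X 0 c F" "x \<in> X"
  shows "(\<lambda>w. deriv (F x) (inverse w)) \<in> O[at 0](\<lambda>w. w powi 2)"
proof -
  obtain f where f: "f has_fps_expansion Abs_fps (\<lambda>k. c k x)"
    and "eventually (\<lambda>w. F x (inverse w) = w powi (- 0) * f w) (at 0)"
    using has_expansion_imp_fps[OF assms] .
  then have ev: "eventually (\<lambda>w. F x (inverse w) = f w) (at 0)"
    by simp
  have an: "eventually (\<lambda>w. f field_differentiable at w) (at 0)"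
  proof -
    obtain S where S: "open S" "0 \<in> S" "f holomorphic_on S"
      using has_fps_expansion_imp_holomorphic[OF f] by metis
    then have "eventually (\<lambda>w. w \<in> S) (at 0)"
      by (simp add: eventually_at_in_open')
    then show ?thesis
      by eventually_elim (use S in \<open>auto simp: holomorphic_on_imp_differentiable_at\<close>)
  qed
  \<comment> \<open>Equality at \<open>w\<close> alone says nothing about derivatives; it is needed
    on a neighbourhood of \<open>w\<close>, which exists because a punctured open set is
    open.\<close>
  have ev2: "eventually (\<lambda>w. eventually (\<lambda>z. F x (inverse z) = f z) (nhds w)) (at 0)"
  proof -
    obtain S where S: "open S" "0 \<in> S" "\<And>z. z \<in> S - {0} \<Longrightarrow> F x (inverse z) = f z"
      using ev unfolding eventually_at_topological by auto
    have "eventually (\<lambda>z. F x (inverse z) = f z) (nhds w)" if "w \<in> S - {0}" for w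
    proof -
      have "eventually (\<lambda>z. z \<in> S - {0}) (nhds w)"
        using S(1) that by (intro eventually_nhds_in_open) auto
      then show ?thesis by eventually_elim (rule S(3))
    qed
    moreover have "eventually (\<lambda>w. w \<in> S - {0}) (at 0)"
      using S by (intro eventually_at_in_open) auto
    ultimately show ?thesis by (auto elim!: eventually_mono)
  qed
  have "eventually (\<lambda>w. deriv (F x) (inverse w) = w powi 2 * - deriv f w) (at 0)"
    using an ev2 eventually_neq_at_within[of 0 0 UNIV]
  proof eventually_elim
    case (elim w)
    have "filterlim inverse (nhds w) (nhds (inverse w))"
      using elim(3) tendsto_inverse[of "\<lambda>z. z" "inverse w" "nhds (inverse w)"]
      by (simp add: filterlim_ident)
    then have "eventually (\<lambda>l. F x (inverse (inverse l)) = f (inverse l)) (nhds (inverse w))"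
      using elim(2) unfolding filterlim_iff by blast
    then have "deriv (F x) (inverse w) = deriv (\<lambda>l. f (inverse l)) (inverse w)"
      by (intro deriv_cong_ev) auto
    also have "\<dots> = w powi 2 * - deriv f w"
    proof (rule DERIV_imp_deriv)
      have "(f has_field_derivative deriv f w) (at (inverse (inverse w)))"
        using elim(1) by (simp add: DERIV_deriv_iff_field_differentiable)
      then have "((\<lambda>l. f (inverse l)) has_field_derivative
            deriv f w * - (inverse (inverse w) ^ Suc (Suc 0))) (at (inverse w))"
        by (rule DERIV_chain2) (rule DERIV_inverse, use elim(3) in simp)
      then show "((\<lambda>l. f (inverse l)) has_field_derivative w powi 2 * - deriv f w) (at (inverse w))"
        by (simp add: power2_eq_square mult_ac)
    qed
    finally show ?case .
  qed
  moreover have "(\<lambda>w. w powi 2 * - deriv f w) \<in> O[at 0](\<lambda>w. w powi 2 * 1)"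
    using has_fps_expansion_bigo_1[OF has_fps_expansion_deriv[OF f]]
    by (intro landau_o.big.mult_left) simp
  ultimately show ?thesis
    using landau_o.big.in_cong by force
qed

section \<open>Orders of growth at \<open>w = 0\<close> of products, traces and inverse
  matrices\<close>

lemma power_int_bigo_mono:
  assumes "q \<le> p"
  shows "(\<lambda>w::complex. w powi p) \<in> O[at 0](\<lambda>w. w powi q)"
proof (rule bigoI[where c = 1])
  have "eventually (\<lambda>w::complex. norm w < 1) (at 0)"
    by (rule order_tendstoD(2)[of norm 0]) (auto intro!: tendsto_eq_intros)
  then show "eventually (\<lambda>w::complex. norm (w powi p) \<le> 1 * norm (w powi q)) (at 0)"
    using eventually_neq_at_within[of 0 0 UNIV]
  proof eventually_elim
    case (elim w)
    then show ?case using assms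
      by (auto simp: norm_power_int intro!: power_int_decreasing)
  qed
qed

lemma power_int_bigo_mult:
  assumes "f \<in> O[at 0](\<lambda>w::complex. w powi p)" "g \<in> O[at 0](\<lambda>w. w powi q)"
  shows "(\<lambda>w. f w * g w) \<in> O[at 0](\<lambda>w. w powi (p + q))"
proof -
  have "eventually (\<lambda>w::complex. w powi p * w powi q = w powi (p + q)) (at 0)"
    using eventually_neq_at_within[of 0 0 UNIV]
    by eventually_elim (simp add: power_int_add)
  then show ?thesis
    using landau_o.big.mult[OF assms] by (simp only: landau_o.big.cong)
qed

lemma matrix_mult_bigo:
  assumes "\<And>i j. (\<lambda>w. A w $ i $ j) \<in> O[at 0](\<lambda>w::complex. w powi p)"
    and "\<And>i j. (\<lambda>w. B w $ i $ j) \<in> O[at 0](\<lambda>w. w powi q)"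
  shows "(\<lambda>w. (A w ** B w) $ i $ j) \<in> O[at 0](\<lambda>w. w powi (p + q))"
  unfolding matrix_matrix_mult_def
  by (simp, intro big_sum_in_bigo power_int_bigo_mult assms)

lemma trace_bigo:
  assumes "\<And>i j. (\<lambda>w. A w $ i $ j) \<in> O[F](g)"
  shows "(\<lambda>w. trace (A w)) \<in> O[F](g)"
  unfolding trace_def by (intro big_sum_in_bigo assms)

lemma tendsto_det:
  fixes A :: "'a \<Rightarrow> 'b::{comm_ring_1, real_normed_algebra} ^ 'n::finite ^ 'n"
  assumes "\<And>i j. ((\<lambda>w. A w $ i $ j) \<longlongrightarrow> B $ i $ j) F"
  shows "((\<lambda>w. det (A w)) \<longlongrightarrow> det B) F"
  unfolding det_def by (intro tendsto_intros tendsto_prod assms)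

lemma matrix_inv_mult:
  fixes A :: "'a::field ^ 'n::finite ^ 'n"
  assumes "det A \<noteq> 0"
  shows "A ** matrix_inv A = mat 1" and "matrix_inv A ** A = mat 1"
proof -
  have "\<exists>B. A ** B = mat 1 \<and> B ** A = mat 1"
    using assms by (simp add: invertible_det_nz[symmetric] invertible_def)
  then have "A ** matrix_inv A = mat 1 \<and> matrix_inv A ** A = mat 1"
    unfolding matrix_inv_def by (rule someI_ex)
  then show "A ** matrix_inv A = mat 1" "matrix_inv A ** A = mat 1"
    by blast+
qed

text \<open>Cramer's rule for column \<open>j\<close> of the inverse. It writes each entry as a
  quotient of determinants, from which continuity of the inverse can be read off.\<close>

lemma matrix_inv_entry:
  fixes A :: "'a::field ^ 'n::finite ^ 'n"
  assumes "det A \<noteq> 0"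
  shows "matrix_inv A $ k $ j = det (\<chi> r s. if s = k then axis j 1 $ r else A $ r $ s) / det A"
proof -
  have "A *v (matrix_inv A *v axis j 1) = axis j 1"
    by (simp add: matrix_vector_mul_assoc matrix_inv_mult[OF assms])
  then have "matrix_inv A *v axis j 1 =
      (\<chi> k. det (\<chi> r s. if s = k then axis j 1 $ r else A $ r $ s) / det A)"
    by (rule iffD1[OF cramer[OF assms]])
  then show ?thesis
    by (simp add: vec_eq_iff matrix_vector_mult_def axis_def if_distrib cong: if_cong)
qed

lemma tendsto_matrix_inv:
  fixes A :: "'a \<Rightarrow> 'b::real_normed_field ^ 'n::finite ^ 'n"
  assumes A: "\<And>i j. ((\<lambda>w. A w $ i $ j) \<longlongrightarrow> B $ i $ j) F" and "det B \<noteq> 0"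
  shows "((\<lambda>w. matrix_inv (A w) $ i $ j) \<longlongrightarrow> matrix_inv B $ i $ j) F"
proof -
  have d: "((\<lambda>w. det (A w)) \<longlongrightarrow> det B) F"
    by (rule tendsto_det[OF A])
  then have "eventually (\<lambda>w. det (A w) \<noteq> 0) F"
    using \<open>det B \<noteq> 0\<close> by (rule tendsto_imp_eventually_ne)
  then have ev: "eventually (\<lambda>w. det (\<chi> r s. if s = i then axis j 1 $ r else A w $ r $ s) / det (A w)
      = matrix_inv (A w) $ i $ j) F"
    by eventually_elim (simp add: matrix_inv_entry)
  have "((\<lambda>w. det (\<chi> r s. if s = i then axis j 1 $ r else A w $ r $ s) / det (A w)) \<longlongrightarrow>
      det (\<chi> r s. if s = i then axis j 1 $ r else B $ r $ s) / det B) F"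
    by (intro tendsto_divide d tendsto_det) (auto simp: A \<open>det B \<noteq> 0\<close>)
  then show ?thesis
    unfolding matrix_inv_entry[OF \<open>det B \<noteq> 0\<close>] using ev by (rule Lim_transform_eventually)
qed

text \<open>A nonzero coefficient at \<open>j\<close> makes the subdegree \<open>d\<close> at most
  \<open>j\<close>, hence less than \<open>p\<close>. But \<open>f\<close> is asymptotic to
  \<open>c * z ^ d\<close>, which is too large to be \<open>O(z powi p)\<close>.\<close>

lemma has_fps_expansion_bigo_imp_nth_eq_0:
  fixes f :: "complex \<Rightarrow> complex"
  assumes f: "f has_fps_expansion A" and O: "f \<in> O[at 0](\<lambda>w. w powi p)" and "int j < p"
  shows "fps_nth A j = 0"
proof (rule ccontr)
  assume nz: "fps_nth A j \<noteq> 0"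
  define d where "d = subdegree A"
  define c where "c = fps_nth A d"
  have "A \<noteq> 0" using nz by auto
  then have "c \<noteq> 0" by (simp add: c_def d_def)
  have "d \<le> j" using nz unfolding d_def by (rule subdegree_leI)
  \<comment> \<open>This is the positive surplus of \<open>p\<close> over \<open>d\<close>:
    cancelling \<open>z ^ d\<close> leaves \<open>norm c\<close> bounded by a multiple of
    \<open>norm (z ^ m)\<close>, which tends to 0.\<close>
  define m where "m = nat (p - int d)"
  have m: "m > 0" "p = int d + int m"
    using \<open>d \<le> j\<close> \<open>int j < p\<close> by (auto simp: m_def)
  have "f \<sim>[at 0] (\<lambda>z. c * z ^ d)"
    using has_fps_expansion_imp_asymp_equiv_0[OF f] by (simp add: c_def d_def asymp_equiv_nhds_iff)
  then have "(\<lambda>z. c * z ^ d) \<in> O[at 0](f)"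
    by (rule asymp_equiv_imp_bigo[OF asymp_equiv_symI])
  then have "(\<lambda>z. c * z ^ d) \<in> O[at 0](\<lambda>w. w powi p)"
    using O by (rule landau_o.big_trans)
  then obtain C where "eventually (\<lambda>z. norm (c * z ^ d) \<le> C * norm (z powi p)) (at 0)"
    by (rule landau_o.bigE)
  then have "eventually (\<lambda>z::complex. norm c \<le> C * norm (z ^ m)) (at 0)"
    using eventually_neq_at_within[of 0 0 UNIV]
  proof eventually_elim
    case (elim z)
    have "z powi p = z ^ d * z ^ m"
      unfolding m(2) using elim(2) by (simp add: power_int_add)
    then have "norm c * norm z ^ d \<le> (C * norm (z ^ m)) * norm z ^ d"
      using elim(1) by (simp add: norm_mult norm_power mult_ac)
    moreover have "norm z ^ d > 0" using elim(2) by simp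
    ultimately show ?case by (rule mult_right_le_imp_le)
  qed
  moreover have "((\<lambda>z::complex. C * norm (z ^ m)) \<longlongrightarrow> C * norm ((0::complex) ^ m)) (at 0)"
    by (intro tendsto_intros)
  ultimately have "norm c \<le> C * norm ((0::complex) ^ m)"
    using tendsto_lowerbound trivial_limit_at by blast
  then show False using \<open>c \<noteq> 0\<close> m(1) by (simp add: zero_power)
qed

section \<open>Boundedness of the partial derivative in the first coordinate\<close>

text \<open>The difference quotients at \<open>x\<close> are bounded by \<open>B\<close>, and so is
  their limit. A Lipschitz estimate based at the single point \<open>x\<close> is enough.\<close>

lemma norm_vector_derivative_le:
  fixes f :: "real \<Rightarrow> 'a::real_normed_vector"
  assumes f: "(f has_vector_derivative v) (at x)"
    and B: "eventually (\<lambda>y. norm (f y - f x) \<le> B * \<bar>y - x\<bar>) (at x)"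
  shows "norm v \<le> B"
proof -
  have lim: "((\<lambda>y. B + norm (f y - f x - (y - x) *\<^sub>R v) / \<bar>y - x\<bar>) \<longlongrightarrow> B + 0) (at x)"
    using f unfolding has_vector_derivative_def has_derivative_iff_norm
    by (intro tendsto_add tendsto_const) auto
  have "eventually (\<lambda>y. norm v \<le> B + norm (f y - f x - (y - x) *\<^sub>R v) / \<bar>y - x\<bar>) (at x)"
    using B eventually_neq_at_within[of x x UNIV]
  proof eventually_elim
    case (elim y)
    have "\<bar>y - x\<bar> * norm v = norm ((f y - f x) - (f y - f x - (y - x) *\<^sub>R v))"
      by simp
    also have "\<dots> \<le> B * \<bar>y - x\<bar> + norm (f y - f x - (y - x) *\<^sub>R v)"
      by (rule order_trans[OF norm_triangle_ineq4 add_right_mono[OF elim(1)]])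
    finally show ?case
      using elim(2) by (simp add: field_simps)
  qed
  then show ?thesis
    using tendsto_lowerbound[OF lim] by simp
qed

text \<open>
  Term-by-term differentiation of the expansion is not available, since nothing is known about the
  coefficients as functions of \<open>x\<close>. Instead, the mean value theorem bounds \<open>F (s, x2) l - F (x1, x2) l\<close> by
  \<open>B * \<bar>s - x1\<bar>\<close> on a circle \<open>norm l = R\<close>, and the maximum modulus principle in \<open>1/l\<close> extends the bound to
  \<open>norm l \<ge> R\<close>.
\<close>

lemma partial1_bigo_1:
  assumes F: "has_expansion X 0 c F" and "x \<in> X"
    and C1: "near_infinity X (\<lambda>x l. (\<lambda>s. F (s, snd x) l) differentiable (at (fst x)) \<and>
        isCont (\<lambda>(y, m). partial1 F y m) (x, l))"
  shows "(\<lambda>w. partial1 F x (inverse w)) \<in> O[at 0](\<lambda>_. 1)"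
proof -
  obtain x1 x2 where x: "x = (x1, x2)" by (cases x)
  obtain Q1 R1 where Q1: "eventually Q1 (nhds x)" "R1 > 0"
    "\<And>y l. Q1 y \<Longrightarrow> norm l \<ge> R1 \<Longrightarrow> (\<lambda>k. c k y * l powi (0 - int k)) sums F y l"
    using near_infinityE[OF F[unfolded has_expansion_def] \<open>x \<in> X\<close>] by blast
  obtain Q2 R2 where Q2: "eventually Q2 (nhds x)" "R2 > 0"
    "\<And>y l. Q2 y \<Longrightarrow> norm l \<ge> R2 \<Longrightarrow> (\<lambda>s. F (s, snd y) l) differentiable (at (fst y)) \<and>
        isCont (\<lambda>(y, m). partial1 F y m) (y, l)"
    using near_infinityE[OF C1 \<open>x \<in> X\<close>] by blast
  \<comment> \<open>The sum exceeds both radii strictly, so the closed disc of radius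
    \<open>1/R\<close> lies inside the open disc of radius \<open>1/R1\<close>, where the series
    converge.\<close>
  define R where "R = R1 + R2"
  have R: "R > R1" "R > R2" "R > 0" using Q1 Q2 by (auto simp: R_def)
  obtain d where d: "d > 0" "\<And>y. dist y x < d \<Longrightarrow> Q1 y \<and> Q2 y"
    using eventually_conj[OF Q1(1) Q2(1)] unfolding eventually_nhds_metric by blast
  define e where "e = d / 2"
  have e: "e > 0" using d by (simp add: e_def)
  have Q: "Q1 (s, x2)" "Q2 (s, x2)" if "s \<in> cball x1 e" for s
  proof -
    have "dist (s, x2) x < d"
      using that d(1) by (simp add: x dist_Pair_Pair e_def dist_commute)
    then show "Q1 (s, x2)" "Q2 (s, x2)" using d(2) by blast+
  qed
  \<comment> \<open>The exterior of the circle is not compact, so the partial derivative is bounded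
    by continuity only over a segment times the circle \<open>norm l = R\<close>.\<close>
  define K where "K = (\<lambda>(s, l). ((s, x2), l)) ` (cball x1 e \<times> sphere (0::complex) R)"
  have "compact K"
    unfolding K_def by (intro compact_continuous_image compact_Times)
      (auto intro!: continuous_intros simp: case_prod_unfold)
  moreover have "continuous_on K (\<lambda>(y, m). partial1 F y m)"
  proof (rule continuous_at_imp_continuous_on, rule ballI)
    fix z assume "z \<in> K"
    then obtain s l where "z = ((s, x2), l)" "s \<in> cball x1 e" "norm l = R"
      unfolding K_def by auto
    then show "isCont (\<lambda>(y, m). partial1 F y m) z"
      using Q2(3)[of "(s, x2)" l] Q R by auto
  qed
  ultimately have "bounded ((\<lambda>(y, m). partial1 F y m) ` K)"
    using compact_continuous_image compact_imp_bounded by blast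
  then obtain B where B: "\<And>z. z \<in> K \<Longrightarrow> norm ((\<lambda>(y, m). partial1 F y m) z) \<le> B"
    unfolding bounded_iff by blast
  have deriv: "((\<lambda>s. F (s, x2) l) has_vector_derivative partial1 F (s, x2) l) (at s)"
    if "s \<in> cball x1 e" "norm l \<ge> R" for s l
    using Q2(3)[of "(s, x2)" l] Q(2)[OF that(1)] that(2) R
    by (simp add: partial1_def vector_derivative_works)
  have circle: "norm (F (s, x2) l - F (x1, x2) l) \<le> B * \<bar>s - x1\<bar>"
    if s: "s \<in> cball x1 e" and l: "norm l = R" for s l
  proof -
    have "norm (F (s, x2) l - F (x1, x2) l) \<le> B * norm (s - x1)"
    proof (rule differentiable_bound[where S = "cball x1 e"])
      fix t assume t: "t \<in> cball x1 e"
      show "((\<lambda>s. F (s, x2) l) has_derivative (\<lambda>h. h *\<^sub>R partial1 F (t, x2) l)) (at t within cball x1 e)"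
        using deriv[OF t] l unfolding has_vector_derivative_def by (auto intro: has_derivative_at_withinI)
      have "norm (partial1 F (t, x2) l) \<le> B"
        using B[of "((t, x2), l)"] t l by (force simp: K_def)
      then show "onorm (\<lambda>h. h *\<^sub>R partial1 F (t, x2) l) \<le> B"
        by (intro onorm_le) (metis abs_ge_zero mult.commute mult_left_mono norm_scaleR real_norm_def)
    qed (use s e in auto)
    then show ?thesis by simp
  qed
  have outside: "norm (F (s, x2) l - F (x1, x2) l) \<le> B * \<bar>s - x1\<bar>"
    if s: "s \<in> cball x1 e" and l: "norm l \<ge> R" for s l
  proof -
    have x1: "x1 \<in> cball x1 e" using e by simp
    define A where "A y = Abs_fps (\<lambda>k. c k y)" for y
    have sums: "(\<lambda>k. c k (t, x2) * w ^ k) sums F (t, x2) (inverse w)"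
      if "t \<in> cball x1 e" "w \<noteq> 0" "norm w \<le> inverse R1" for t w
    proof -
      have "norm (inverse w) \<ge> R1"
        using that(2,3) Q1(2) by (simp add: norm_divide field_simps)
      then show ?thesis
        using Q1(3)[OF Q(1)[OF that(1)], of "inverse w"] power_int_expansion[of "inverse w" _ 0] that(2)
        by simp
    qed
    have eval: "eval_fps (A (t, x2)) w = F (t, x2) (inverse w)"
      if "t \<in> cball x1 e" "w \<noteq> 0" "norm w \<le> inverse R1" for t w
      using sums[OF that] by (simp add: A_def eval_fps_def sums_iff)
    \<comment> \<open>The radius \<open>R1\<close> works for every \<open>t\<close> in the segment,
      so all these series share one lower bound on the radius of convergence; it is obtained by
      evaluating at the real point \<open>1/R1\<close>.\<close>
    have rad: "ereal (inverse R1) \<le> fps_conv_radius (A (t, x2))" if "t \<in> cball x1 e" for t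
    proof -
      have "summable (\<lambda>k. c k (t, x2) * (complex_of_real (inverse R1)) ^ k)"
        using sums[OF that, of "complex_of_real (inverse R1)"] Q1(2) by (auto simp: sums_iff norm_inverse)
      from conv_radius_geI[OF this] show ?thesis
        using Q1(2) by (simp add: fps_conv_radius_def A_def norm_inverse)
    qed
    have less: "inverse R < inverse R1" using R Q1(2) by simp
    have sub: "cball 0 (inverse R) \<subseteq> eball (0::complex) (fps_conv_radius (A (t, x2)))"
      if t: "t \<in> cball x1 e" for t
    proof (rule subsetI)
      fix w :: complex assume "w \<in> cball 0 (inverse R)"
      then have "ereal (norm w) < ereal (inverse R1)" using less by simp
      then have "ereal (norm w) < fps_conv_radius (A (t, x2))"
        using rad[OF t] by (rule less_le_trans)
      then show "w \<in> eball 0 (fps_conv_radius (A (t, x2)))"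
        by (simp add: in_eball_iff)
    qed
    have hol: "eval_fps (A (t, x2)) holomorphic_on cball 0 (inverse R)" if "t \<in> cball x1 e" for t
      using sub[OF that] by (rule holomorphic_on_eval_fps)
    \<comment> \<open>Defined through the power series, \<open>g\<close> is holomorphic also at
      \<open>w = 0\<close>, the point at infinity. There \<open>inverse 0 = 0\<close> in HOL, so the
      comparison with \<open>F\<close> in \<open>gF\<close> is restricted to nonzero
      \<open>w\<close>.\<close>
    define g where "g w = eval_fps (A (s, x2)) w - eval_fps (A (x1, x2)) w" for w
    have g: "g holomorphic_on cball 0 (inverse R)"
      unfolding g_def by (intro holomorphic_intros hol s x1)
    have gF: "g w = F (s, x2) (inverse w) - F (x1, x2) (inverse w)"
      if "w \<noteq> 0" "norm w \<le> inverse R" for w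
      unfolding g_def using eval[OF s that(1)] eval[OF x1 that(1)] that(2) less by simp
    have "norm (g (inverse l)) \<le> B * \<bar>s - x1\<bar>"
    proof (rule maximum_modulus_frontier[where f = g and S = "cball 0 (inverse R)"])
      show "g holomorphic_on interior (cball 0 (inverse R))"
        using g by (rule holomorphic_on_subset) (rule interior_subset)
      show "continuous_on (closure (cball 0 (inverse R))) g"
        using holomorphic_on_imp_continuous_on[OF g] by simp
      show "norm (g w) \<le> B * \<bar>s - x1\<bar>" if "w \<in> frontier (cball 0 (inverse R))" for w
      proof -
        have w: "norm w = inverse R" using that by simp
        then have "w \<noteq> 0" using R by auto
        then show ?thesis
          using w gF[of w] circle[OF s, of "inverse w"] by (simp add: norm_inverse)
      qed
      show "inverse l \<in> cball 0 (inverse R)"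
        using le_imp_inverse_le[OF l R(3)] by (simp add: norm_inverse)
    qed simp
    moreover have "l \<noteq> 0" using l R(3) by auto
    ultimately show ?thesis
      using gF[of "inverse l"] le_imp_inverse_le[OF l R(3)] by (simp add: norm_inverse)
  qed
  \<comment> \<open>The constant \<open>B\<close> does not depend on \<open>l\<close>; letting
    \<open>s\<close> tend to \<open>x1\<close> passes it on to the derivative, uniformly in
    \<open>l\<close>.\<close>
  have bound: "norm (partial1 F x l) \<le> B" if "norm l \<ge> R" for l
  proof -
    have "((\<lambda>s. F (s, x2) l) has_vector_derivative partial1 F (x1, x2) l) (at x1)"
      using deriv[of x1 l] that e by simp
    moreover have "eventually (\<lambda>s. norm (F (s, x2) l - F (x1, x2) l) \<le> B * \<bar>s - x1\<bar>) (at x1)"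
    proof -
      have "eventually (\<lambda>s. s \<in> ball x1 e) (at x1)"
        using e by (intro eventually_at_in_open') auto
      then show ?thesis
        by eventually_elim (use outside that in auto)
    qed
    ultimately show ?thesis
      unfolding x by (rule norm_vector_derivative_le)
  qed
  have "eventually (\<lambda>w. norm w \<le> inverse R) (at (0::complex))"
    using eventually_at_in_open'[of "ball 0 (inverse R)" "0::complex"] R
    by (auto elim!: eventually_mono)
  then have "eventually (\<lambda>w. norm (partial1 F x (inverse w)) \<le> B * norm (1::complex)) (at 0)"
    using eventually_neq_at_within[of 0 0 UNIV]
  proof eventually_elim
    case (elim w)
    then have "norm (inverse w) \<ge> R" using R by (simp add: norm_divide field_simps)
    then show ?case using bound by simp
  qed
  then show ?thesis by (rule bigoI)
qed

section \<open>Traces of squares and their change under the Darboux transformation\<close>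

text \<open>The trace of a square is a sum of products of entries, and the Cauchy product of the
  entry series collects exactly the bilinear sums of the constraints. The two factors
  \<open>w powi (- m)\<close> combine into the prefactor.\<close>

lemma trace_square_expansion:
  assumes F: "has_matrix_expansion X m c F" and "x \<in> X"
  obtains G where
    "G has_fps_expansion Abs_fps (\<lambda>n. \<Sum>i=0..n. trace (c i x ** c (n - i) x))"
    "eventually (\<lambda>w. trace (F x (inverse w) ** F x (inverse w)) = w powi (- (2 * m)) * G w) (at 0)"
proof -
  have "\<exists>f. f has_fps_expansion Abs_fps (\<lambda>k. c k x $ i $ j) \<and>
      eventually (\<lambda>w. F x (inverse w) $ i $ j = w powi (- m) * f w) (at 0)" for i j
  proof -
    have "has_expansion X m (\<lambda>k x. c k x $ i $ j) (entry i j F)"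
      using F by (simp add: has_matrix_expansion_def)
    then show ?thesis
      using \<open>x \<in> X\<close> unfolding entry_def by (rule has_expansion_imp_fps) (intro exI conjI)
  qed
  then have "\<forall>i j. \<exists>f. f has_fps_expansion Abs_fps (\<lambda>k. c k x $ i $ j) \<and>
      eventually (\<lambda>w. F x (inverse w) $ i $ j = w powi (- m) * f w) (at 0)"
    by (intro allI)
  then obtain f where "\<forall>i j. f i j has_fps_expansion Abs_fps (\<lambda>k. c k x $ i $ j) \<and>
      eventually (\<lambda>w. F x (inverse w) $ i $ j = w powi (- m) * f i j w) (at 0)"
    unfolding choice_iff by (elim exE)
  then have f: "\<And>i j. f i j has_fps_expansion Abs_fps (\<lambda>k. c k x $ i $ j)"
    and ev: "\<And>i j. eventually (\<lambda>w. F x (inverse w) $ i $ j = w powi (- m) * f i j w) (at 0)"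
    by simp_all
  define G where "G w = (\<Sum>i\<in>UNIV. \<Sum>j\<in>UNIV. f i j w * f j i w)" for w
  have "G has_fps_expansion
      (\<Sum>i\<in>UNIV. \<Sum>j\<in>UNIV. Abs_fps (\<lambda>k. c k x $ i $ j) * Abs_fps (\<lambda>k. c k x $ j $ i))"
    unfolding G_def by (intro fps_expansion_intros f)
  also have "(\<Sum>i\<in>UNIV. \<Sum>j\<in>UNIV. Abs_fps (\<lambda>k. c k x $ i $ j) * Abs_fps (\<lambda>k. c k x $ j $ i))
      = Abs_fps (\<lambda>n. \<Sum>i=0..n. trace (c i x ** c (n - i) x))"
  proof (rule fps_ext)
    fix n
    have "(\<Sum>i\<in>UNIV. \<Sum>j\<in>UNIV. \<Sum>k=0..n. c k x $ i $ j * c (n - k) x $ j $ i)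
        = (\<Sum>k=0..n. \<Sum>i\<in>UNIV. \<Sum>j\<in>UNIV. c k x $ i $ j * c (n - k) x $ j $ i)"
      by (subst sum.swap, subst (2) sum.swap) (rule refl)
    then show "fps_nth (\<Sum>i\<in>UNIV. \<Sum>j\<in>UNIV. Abs_fps (\<lambda>k. c k x $ i $ j) * Abs_fps (\<lambda>k. c k x $ j $ i)) n
        = fps_nth (Abs_fps (\<lambda>n. \<Sum>i=0..n. trace (c i x ** c (n - i) x))) n"
      by (simp add: fps_sum_nth fps_mult_nth trace_def matrix_matrix_mult_def)
  qed
  finally have G: "G has_fps_expansion Abs_fps (\<lambda>n. \<Sum>i=0..n. trace (c i x ** c (n - i) x))" .
  have "eventually (\<lambda>w. \<forall>i j. F x (inverse w) $ i $ j = w powi (- m) * f i j w) (at 0)"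
    by (intro eventually_all_finite ev)
  then have "eventually (\<lambda>w. trace (F x (inverse w) ** F x (inverse w)) = w powi (- (2 * m)) * G w) (at 0)"
    using eventually_neq_at_within[of 0 0 UNIV]
  proof eventually_elim
    case (elim w)
    have "w powi (- (2 * m)) = w powi (- m) * w powi (- m)"
      using elim(2) by (simp add: power_int_add[symmetric])
    then show ?case
      by (simp add: trace_def matrix_matrix_mult_def elim(1) G_def sum_distrib_left mult_ac)
  qed
  with G show ?thesis using that by blast
qed

text \<open>The inner \<open>B ** A\<close> cancels in the square of the conjugate, and cyclicity of
  the trace removes the outer pair. Cyclicity also makes the two mixed terms equal.\<close>

lemma trace_square_gauge:
  fixes A B C M :: "'a::comm_ring_1 ^ 'n::finite ^ 'n"
  assumes "B ** A = mat 1"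
  shows "trace ((M + A ** C ** B) ** (M + A ** C ** B)) =
    trace (M ** M) + 2 * trace (M ** (A ** C ** B)) + trace (C ** C)"
proof -
  let ?V = "A ** C ** B"
  have "trace (?V ** ?V) = trace ((A ** (C ** C)) ** B)"
    by (metis assms matrix_mul_assoc matrix_mul_rid)
  also have "\<dots> = trace (C ** C)"
    by (metis assms matrix_mul_assoc matrix_mul_lid trace_mul_sym)
  finally have V: "trace (?V ** ?V) = trace (C ** C)" .
  have "(M + ?V) ** Z = M ** Z + ?V ** Z" for Z :: "'a ^ 'n ^ 'n"
    by (simp add: matrix_matrix_mult_def vec_eq_iff distrib_right sum.distrib)
  then show ?thesis
    by (simp add: matrix_add_ldistrib trace_add trace_mul_sym[of ?V M] V algebra_simps)
qed

text \<open>The partial derivative is bounded, while the chain rule term is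
  \<open>O(w powi 2)\<close> times \<open>O(w powi (- N'))\<close>. The smaller exponent covers
  both.\<close>

lemma total1_bigo:
  assumes F: "has_expansion X 0 c F" and "x \<in> X"
    and C1: "near_infinity X (\<lambda>x l. (\<lambda>s. F (s, snd x) l) differentiable (at (fst x)) \<and>
        isCont (\<lambda>(y, m). partial1 F y m) (x, l))"
    and L: "has_expansion X N' a L"
  shows "(\<lambda>w. total1 L F x (inverse w)) \<in> O[at 0](\<lambda>w. w powi min 0 (2 - N'))"
  unfolding total1_def
proof (rule sum_in_bigo)
  have "(\<lambda>w. partial1 F x (inverse w)) \<in> O[at 0](\<lambda>w. w powi 0)"
    using partial1_bigo_1[OF F \<open>x \<in> X\<close> C1] by simp
  then show "(\<lambda>w. partial1 F x (inverse w)) \<in> O[at 0](\<lambda>w. w powi min 0 (2 - N'))"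
    by (rule landau_o.big_trans) (rule power_int_bigo_mono, simp)
  have "(\<lambda>w. deriv (F x) (inverse w) * L x (inverse w)) \<in> O[at 0](\<lambda>w. w powi (2 + - N'))"
    by (intro power_int_bigo_mult has_expansion_0_deriv_bigo[OF F \<open>x \<in> X\<close>]
        has_expansion_bigo[OF L \<open>x \<in> X\<close>])
  then show "(\<lambda>w. deriv (F x) (inverse w) * L x (inverse w)) \<in> O[at 0](\<lambda>w. w powi min 0 (2 - N'))"
    by (rule landau_o.big_trans) (rule power_int_bigo_mono, simp)
qed

text \<open>The two bounds on \<open>q\<close> are the orders of the two extra terms: the square of
  \<open>M\<close> contributes twice the order of \<open>M\<close>, and the mixed term adds the
  order \<open>- m\<close> of the conjugated \<open>U\<close>.\<close>

lemma darboux_trace_square_bigo: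
  fixes D U :: "point \<Rightarrow> complex \<Rightarrow> 'n::finite cmatrix"
  assumes U: "has_matrix_expansion X m u U" and L: "has_expansion X N' a L"
    and D: "has_matrix_expansion X 0 T D" and C1: "C1_in_x1 X D"
    and "x \<in> X" and det: "det (T 0 x) \<noteq> 0"
    and q: "q \<le> 2 * min 0 (2 - N')" "q \<le> min 0 (2 - N') - m"
  shows "(\<lambda>w. trace (darboux L D U x (inverse w) ** darboux L D U x (inverse w))
      - trace (U x (inverse w) ** U x (inverse w))) \<in> O[at 0](\<lambda>w. w powi q)"
proof -
  define p where "p = min 0 (2 - N')"
  define Dw where "Dw w = D x (inverse w)" for w
  define Uw where "Uw w = U x (inverse w)" for w
  define Iw where "Iw w = matrix_inv (D x (inverse w))" for w
  define M where "M w = matrix_total1 L D x (inverse w) ** Iw w" for w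
  define V where "V w = Dw w ** Uw w ** Iw w" for w
  have D': "has_expansion X 0 (\<lambda>k x. T k x $ i $ j) (entry i j D)" for i j
    using D by (simp add: has_matrix_expansion_def)
  have lim: "((\<lambda>w. Dw w $ i $ j) \<longlongrightarrow> T 0 x $ i $ j) (at 0)" for i j
  proof -
    obtain f where f: "f has_fps_expansion Abs_fps (\<lambda>k. T k x $ i $ j)"
      and ev: "eventually (\<lambda>w. entry i j D x (inverse w) = w powi (- 0) * f w) (at 0)"
      by (rule has_expansion_imp_fps[OF D' \<open>x \<in> X\<close>])
    from ev have "eventually (\<lambda>w. f w = Dw w $ i $ j) (at 0)"
      by eventually_elim (simp add: entry_def Dw_def)
    then show ?thesis
      using has_fps_expansion_imp_tendsto_0[OF f]
      by (auto simp: tendsto_nhds_iff intro: Lim_transform_eventually)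
  qed
  have bD: "(\<lambda>w. Dw w $ i $ j) \<in> O[at 0](\<lambda>w. w powi 0)" for i j
    using lim by (intro bigoI_tendsto) auto
  \<comment> \<open>Here the condition on \<open>T 0 x\<close> enters: \<open>D\<close> tends to
    \<open>T 0 x\<close> at infinity, so its inverse has a finite limit.\<close>
  have bI: "(\<lambda>w. Iw w $ i $ j) \<in> O[at 0](\<lambda>w. w powi 0)" for i j
  proof -
    have "((\<lambda>w. Iw w $ i $ j) \<longlongrightarrow> matrix_inv (T 0 x) $ i $ j) (at 0)"
      unfolding Iw_def by (intro tendsto_matrix_inv det lim[unfolded Dw_def])
    then show ?thesis by (intro bigoI_tendsto) auto
  qed
  have bU: "(\<lambda>w. Uw w $ i $ j) \<in> O[at 0](\<lambda>w. w powi (- m))" for i j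
    using has_expansion_bigo[of X m "\<lambda>k x. u k x $ i $ j" "entry i j U" x] U \<open>x \<in> X\<close>
    by (simp add: has_matrix_expansion_def entry_def Uw_def)
  have bT: "(\<lambda>w. matrix_total1 L D x (inverse w) $ i $ j) \<in> O[at 0](\<lambda>w. w powi p)" for i j
    using total1_bigo[OF D' \<open>x \<in> X\<close> _ L] C1
    by (simp add: C1_in_x1_def matrix_total1_def p_def)
  have bM: "(\<lambda>w. M w $ i $ j) \<in> O[at 0](\<lambda>w. w powi p)" for i j
    using matrix_mult_bigo[OF bT bI] by (simp add: M_def)
  have bV: "(\<lambda>w. V w $ i $ j) \<in> O[at 0](\<lambda>w. w powi (- m))" for i j
    using matrix_mult_bigo[OF matrix_mult_bigo[OF bD bU] bI] by (simp add: V_def)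
  have MM: "(\<lambda>w. trace (M w ** M w)) \<in> O[at 0](\<lambda>w. w powi q)"
    using trace_bigo[OF matrix_mult_bigo[OF bM bM]]
    by (rule landau_o.big_trans) (rule power_int_bigo_mono, use q in \<open>simp add: p_def\<close>)
  have MV: "(\<lambda>w. trace (M w ** V w)) \<in> O[at 0](\<lambda>w. w powi q)"
    using trace_bigo[OF matrix_mult_bigo[OF bM bV]]
    by (rule landau_o.big_trans) (rule power_int_bigo_mono, use q in \<open>simp add: p_def\<close>)
  have "eventually (\<lambda>w. det (Dw w) \<noteq> 0) (at 0)"
    using tendsto_det[OF lim] det by (rule tendsto_imp_eventually_ne)
  then have "eventually (\<lambda>w. trace (darboux L D U x (inverse w) ** darboux L D U x (inverse w))
      - trace (U x (inverse w) ** U x (inverse w)) = trace (M w ** M w) + 2 * trace (M w ** V w)) (at 0)"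
  proof eventually_elim
    case (elim w)
    have "Iw w ** Dw w = mat 1"
      using matrix_inv_mult(2)[OF elim] by (simp add: Iw_def Dw_def)
    from trace_square_gauge[OF this, of "M w" "Uw w"] show ?case
      by (simp add: darboux_def M_def V_def Dw_def Uw_def Iw_def)
  qed
  moreover have "(\<lambda>w. trace (M w ** M w) + 2 * trace (M w ** V w)) \<in> O[at 0](\<lambda>w. w powi q)"
    using MM MV by (intro sum_in_bigo) auto
  ultimately show ?thesis
    using landau_o.big.in_cong by force
qed

section \<open>Comparison of coefficients and preservation of the constraints\<close>

theorem proposition8p5:
  fixes X :: "point set"
    and N k :: nat
    and N' :: int
    and u ut T :: "nat \<Rightarrow> point \<Rightarrow> 'n::finite cmatrix"
    and a g :: "nat \<Rightarrow> point \<Rightarrow> complex"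
    and U D :: "point \<Rightarrow> complex \<Rightarrow> 'n cmatrix"
    and L :: "point \<Rightarrow> complex \<Rightarrow> complex"
  assumes "open X"
    and "N > 0"
    and "has_matrix_expansion X (int N) u U"
    and "spectral_evolution X N' a L"
    and "has_matrix_expansion X 0 T D"
    and "C1_in_x1 X D"
    and "\<And>x. x \<in> X \<Longrightarrow> det (T 0 x) \<noteq> 0"
    and "has_matrix_expansion X (int N) ut (darboux L D U)"
    and "int k \<le> kmax3 (int N) N'"
    and "\<And>j x. j \<le> k \<Longrightarrow> x \<in> X \<Longrightarrow> (\<Sum>i=0..j. trace (u i x ** u (j - i) x)) = g j x"
  shows "\<forall>j\<le>k. \<forall>x\<in>X. (\<Sum>i=0..j. trace (ut i x ** ut (j - i) x)) = g j x"
proof (intro allI impI ballI)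
  fix j x assume "j \<le> k" "x \<in> X"
  define b where "b = (\<lambda>j. \<Sum>i=0..j. trace (u i x ** u (j - i) x))"
  define bt where "bt = (\<lambda>j. \<Sum>i=0..j. trace (ut i x ** ut (j - i) x))"
  obtain G where G: "G has_fps_expansion Abs_fps b"
    and evG: "eventually (\<lambda>w. trace (U x (inverse w) ** U x (inverse w)) = w powi (- (2 * int N)) * G w) (at 0)"
    unfolding b_def by (rule trace_square_expansion[OF assms(3) \<open>x \<in> X\<close>])
  obtain H where H: "H has_fps_expansion Abs_fps bt"
    and evH: "eventually (\<lambda>w. trace (darboux L D U x (inverse w) ** darboux L D U x (inverse w))
        = w powi (- (2 * int N)) * H w) (at 0)"
    unfolding bt_def by (rule trace_square_expansion[OF assms(8) \<open>x \<in> X\<close>])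
  define p where "p = min 0 (2 - N')"
  \<comment> \<open>The worse of the orders of the two extra terms, with \<open>p\<close> the order
    of \<open>M\<close>.\<close>
  define q where "q = min (2 * p) (p - int N)"
  have "has_expansion X N' a L"
    using assms(4) by (simp add: spectral_evolution_def)
  then have "(\<lambda>w. trace (darboux L D U x (inverse w) ** darboux L D U x (inverse w))
      - trace (U x (inverse w) ** U x (inverse w))) \<in> O[at 0](\<lambda>w. w powi q)"
    using darboux_trace_square_bigo[OF assms(3) _ assms(5,6) \<open>x \<in> X\<close> assms(7)[OF \<open>x \<in> X\<close>]]
    by (simp add: q_def p_def)
  \<comment> \<open>Multiplication by \<open>w powi (2 * int N)\<close> removes the common
    prefactor, leaving the difference of the two power series whose coefficients are the bilinear
    sums.\<close>
  then have "(\<lambda>w. w powi (2 * int N) * (trace (darboux L D U x (inverse w) ** darboux L D U x (inverse w))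
      - trace (U x (inverse w) ** U x (inverse w)))) \<in> O[at 0](\<lambda>w. w powi (2 * int N + q))"
    by (intro power_int_bigo_mult) auto
  moreover have "eventually (\<lambda>w. w powi (2 * int N) *
      (trace (darboux L D U x (inverse w) ** darboux L D U x (inverse w))
      - trace (U x (inverse w) ** U x (inverse w))) = H w - G w) (at 0)"
    using evG evH eventually_neq_at_within[of 0 0 UNIV]
    by eventually_elim (simp add: power_int_minus field_simps)
  ultimately have "(\<lambda>w. H w - G w) \<in> O[at 0](\<lambda>w. w powi (2 * int N + q))"
    using landau_o.big.in_cong by force
  moreover have "(\<lambda>w. H w - G w) has_fps_expansion Abs_fps bt - Abs_fps b"
    by (intro fps_expansion_intros G H)
  \<comment> \<open>By the definition of \<open>p\<close>, the number \<open>2 * int N + q\<close>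
    is the least of \<open>N\<close>, \<open>N + 2 - N'\<close>, \<open>2 * N\<close> and
    \<open>2 * N + 4 - 2 * N'\<close>. One less than each of these is an entry of
    \<open>kmax3\<close>, hence the strict inequality.\<close>
  moreover have "int j < 2 * int N + q"
  proof -
    have "int k \<le> int N - 1" "int k \<le> int N + 1 - N'" "int k \<le> 2 * int N + 3 - 2 * N'"
      using assms(9) by (simp_all add: kmax3_def)
    then show ?thesis
      using \<open>j \<le> k\<close> by (auto simp: q_def p_def min_def)
  qed
  ultimately have "fps_nth (Abs_fps bt - Abs_fps b) j = 0"
    using has_fps_expansion_bigo_imp_nth_eq_0 by blast
  then have "bt j = b j" by simp
  then show "(\<Sum>i=0..j. trace (ut i x ** ut (j - i) x)) = g j x"
    using assms(10)[OF \<open>j \<le> k\<close> \<open>x \<in> X\<close>] by (simp add: b_def bt_def)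
qed

end
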